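(* Let $\kappa\le\lambda$ be cardinals with $\kappa$ regular and uncountable, and suppose $\operatorname{cf}\lambda\ge\kappa$. Then $\{a\in P_\kappa\lambda \mid \operatorname{Lim} a\cap \operatorname{cof}\omega\subseteq a\}\in F_{\mathrm{IT}}[\kappa,\lambda]$.
   Context: For a set of ordinals $a$, $\operatorname{Lim} a$ is the set of limit points of $a$ (limit ordinals $\delta>0$ with $\sup(a\cap\delta)=\delta$); $\operatorname{cof}\omega$ is the class of ordinals of cofinality $\omega$. $P_\kappa\lambda$ is the set of subsets of $\lambda$ of size $<\kappa$; stationary/club in the usual sense. A $P_\kappa\lambda$-list is $\langle d_a\mid a\in P_\kappa\lambda\rangle$ with $d_a\subseteq a$; it is thin if there is a club $C\subseteq P_\kappa\lambda$ with $|\{d_a\cap c\mid c\subseteq a\in P_\kappa\lambda\}|<\kappa$ for all $c\in C$. For $A\subseteq P_\kappa\lambda$, a list is $A$-effable if for every $S\subseteq A$ stationary in $P_\kappa\lambda$ there are $a,b\in S$ with $a\subseteq b$ and $d_a\neq d_b\cap a$. $I_{\mathrm{IT}}[\kappa,\lambda]$ is the set of $A\subseteq P_\kappa\lambda$ for which a thin $A$-effable $P_\kappa\lambda$-list exists, and $F_{\mathrm{IT}}[\kappa,\lambda]=\{P_\kappa\lambda\setminus A\mid A\in I_{\mathrm{IT}}[\kappa,\lambda]\}$ is its dual filter. *)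

theory Defs
  imports Main "HOL-Library.Equipollence" "HOL-Library.Countable_Set"
begin

text \<open>
  Ordinals are the elements of an arbitrary well-ordered type \<open>'a\<close>: an element \<open>\<alpha>\<close> stands for the
  order type of \<open>{..<\<alpha>}\<close>, and \<open>{..<\<alpha>}\<close> is the von Neumann ordinal \<open>\<alpha>\<close> viewed as a set. Cardinals
  are initial ordinals, so \<open>|X| < \<kappa>\<close> reads \<open>X \<prec> {..<\<kappa>}\<close>.
\<close>

definition cardinal :: "'a::wellorder \<Rightarrow> bool" where
  "cardinal \<kappa> \<longleftrightarrow> (\<forall>\<beta><\<kappa>. \<not> {..<\<beta>} \<approx> {..<\<kappa>})"

definition limit_ord :: "'a::wellorder \<Rightarrow> bool" where
  "limit_ord \<delta> \<longleftrightarrow> (\<exists>\<beta>. \<beta> < \<delta>) \<and> (\<forall>\<beta><\<delta>. \<exists>\<gamma>. \<beta> < \<gamma> \<and> \<gamma> < \<delta>)"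

text \<open>Meaningful only if \<open>'a\<close> contains a limit ordinal, e.g. an uncountable one.\<close>

definition omega :: "'a::wellorder" where
  "omega = (LEAST \<delta>. limit_ord \<delta>)"

text \<open>The set below contains \<open>\<delta>\<close> itself, via the identity, so the minimum exists.\<close>

definition cf :: "'a::wellorder \<Rightarrow> 'a" where
  "cf \<delta> = (LEAST \<beta>. \<exists>f. f ` {..<\<beta>} \<subseteq> {..<\<delta>} \<and> (\<forall>\<xi><\<delta>. \<exists>\<eta><\<beta>. \<xi> \<le> f \<eta>))"

definition regular :: "'a::wellorder \<Rightarrow> bool" where
  "regular \<kappa> \<longleftrightarrow> infinite {..<\<kappa>} \<and> cf \<kappa> = \<kappa>"

definition cof_omega :: "'a::wellorder set" where
  "cof_omega = {\<delta>. cf \<delta> = omega}"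

text \<open>The type \<open>'a\<close> need not be complete; \<open>sup_ord X\<close> is the supremum of sets \<open>X\<close> bounded in \<open>'a\<close>.\<close>

definition sup_ord :: "'a::wellorder set \<Rightarrow> 'a" where
  "sup_ord X = (LEAST \<beta>. \<forall>\<xi>\<in>X. \<xi> \<le> \<beta>)"

definition limit_points :: "'a::wellorder set \<Rightarrow> 'a set" where
  "limit_points a = {\<delta>. limit_ord \<delta> \<and> sup_ord (a \<inter> {..<\<delta>}) = \<delta>}"

definition Pk :: "'a::wellorder \<Rightarrow> 'a \<Rightarrow> 'a set set" where
  "Pk \<kappa> \<Lambda> = {a. a \<subseteq> {..<\<Lambda>} \<and> a \<prec> {..<\<kappa>}}"

text \<open>Closedness: unions of nonempty \<open>\<subseteq>\<close>-chains of fewer than \<open>\<kappa>\<close> members stay in the set.\<close>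

definition club :: "'a::wellorder \<Rightarrow> 'a \<Rightarrow> 'a set set \<Rightarrow> bool" where
  "club \<kappa> \<Lambda> C \<longleftrightarrow> C \<subseteq> Pk \<kappa> \<Lambda>
     \<and> (\<forall>a\<in>Pk \<kappa> \<Lambda>. \<exists>c\<in>C. a \<subseteq> c)
     \<and> (\<forall>D. subset.chain C D \<and> D \<noteq> {} \<and> D \<prec> {..<\<kappa>} \<longrightarrow> \<Union>D \<in> C)"

definition stationary :: "'a::wellorder \<Rightarrow> 'a \<Rightarrow> 'a set set \<Rightarrow> bool" where
  "stationary \<kappa> \<Lambda> S \<longleftrightarrow> S \<subseteq> Pk \<kappa> \<Lambda> \<and> (\<forall>C. club \<kappa> \<Lambda> C \<longrightarrow> S \<inter> C \<noteq> {})"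

text \<open>A list is a total function whose values outside \<open>Pk \<kappa> \<Lambda>\<close> are irrelevant.\<close>

definition Pk_list :: "'a::wellorder \<Rightarrow> 'a \<Rightarrow> ('a set \<Rightarrow> 'a set) \<Rightarrow> bool" where
  "Pk_list \<kappa> \<Lambda> d \<longleftrightarrow> (\<forall>a\<in>Pk \<kappa> \<Lambda>. d a \<subseteq> a)"

definition thin :: "'a::wellorder \<Rightarrow> 'a \<Rightarrow> ('a set \<Rightarrow> 'a set) \<Rightarrow> bool" where
  "thin \<kappa> \<Lambda> d \<longleftrightarrow> (\<exists>C. club \<kappa> \<Lambda> C \<and>
     (\<forall>c\<in>C. {d a \<inter> c | a. c \<subseteq> a \<and> a \<in> Pk \<kappa> \<Lambda>} \<prec> {..<\<kappa>}))"

definition effable :: "'a::wellorder \<Rightarrow> 'a \<Rightarrow> 'a set set \<Rightarrow> ('a set \<Rightarrow> 'a set) \<Rightarrow> bool" where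
  "effable \<kappa> \<Lambda> A d \<longleftrightarrow> (\<forall>S. S \<subseteq> A \<and> stationary \<kappa> \<Lambda> S \<longrightarrow>
     (\<exists>a\<in>S. \<exists>b\<in>S. a \<subseteq> b \<and> d a \<noteq> d b \<inter> a))"

definition I_IT :: "'a::wellorder \<Rightarrow> 'a \<Rightarrow> 'a set set set" where
  "I_IT \<kappa> \<Lambda> = {A. A \<subseteq> Pk \<kappa> \<Lambda> \<and>
     (\<exists>d. Pk_list \<kappa> \<Lambda> d \<and> thin \<kappa> \<Lambda> d \<and> effable \<kappa> \<Lambda> A d)}"

definition F_IT :: "'a::wellorder \<Rightarrow> 'a \<Rightarrow> 'a set set set" where
  "F_IT \<kappa> \<Lambda> = {Pk \<kappa> \<Lambda> - A | A. A \<in> I_IT \<kappa> \<Lambda>}"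

end

theory Submission
  imports Defs
begin

text \<open>
  Fix an increasing cofinal ladder \<open>l\<^sub>\<delta>\<close> of length \<open>\<omega>\<close> in every \<open>\<delta>\<close> of countable cofinality and an
  injection \<open>p\<close> of \<open>\<Lambda> \<times> \<omega>\<close> into \<open>\<Lambda>\<close>. If \<open>a\<close> omits some \<open>\<eta> \<in> Lim a \<inter> cof \<omega>\<close>, let \<open>d\<^sub>a\<close> code the
  sequence of the sets \<open>{x \<in> a. x < l\<^sub>\<eta>(n)}\<close>, \<open>n < \<omega>\<close>, through \<open>p\<close>; otherwise let \<open>d\<^sub>a\<close> be empty.
  If the \<open>d\<^sub>a\<close> cohered on a cofinal set of such \<open>a\<close>, they would glue to an increasing sequence of
  initial segments of \<open>\<Lambda>\<close> whose union is, as \<open>cf \<Lambda> > \<omega>\<close>, some \<open>\<delta> < \<Lambda>\<close>.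
  Any \<open>a\<close> in the set that contains \<open>\<delta>\<close> and a fixed sequence cofinal in \<open>\<delta>\<close> would then have
  \<open>\<eta> = \<delta> \<in> a\<close>, a contradiction.
\<close>

unbundle cardinal_syntax

section \<open>Sets of size below a regular cardinal\<close>

lemma lepoll_iff_ordLeq: "A \<lesssim> B \<longleftrightarrow> |A| \<le>o |B|"
  by (simp add: lepoll_def card_of_ordLeq)

text \<open>The order below \<open>\<kappa>\<close> is recast as a relation \<open>r\<close> to
  bring in the comparison of well-orders: the cardinal \<open>|X|\<close> is at most
  \<open>r\<close> and not isomorphic to it, hence isomorphic to a proper initial segment of
  \<open>r\<close>.\<close>

lemma lesspoll_imp_eqpoll_segment:
  fixes \<kappa> :: "'a::wellorder"
  assumes "X \<prec> {..<\<kappa>}"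
  obtains \<beta> where "\<beta> < \<kappa>" "X \<approx> {..<\<beta>}"
proof -
  define r where "r = {(x, y). x \<le> y \<and> y < \<kappa>}"
  have F: "Field r = {..<\<kappa>}"
    by (auto simp: r_def Field_def)
  have wf: "wf (r - Id)"
    by (rule wf_subset[OF wf]) (auto simp: r_def)
  have "Well_order r"
    using wf unfolding well_order_on_def linear_order_on_def partial_order_on_def preorder_on_def F
    by (auto simp: refl_on_def trans_def antisym_def total_on_def r_def)
  have "|X| \<le>o |Field r|" and ne: "\<not> {..<\<kappa>} \<lesssim> X"
    using assms by (auto simp: F lesspoll_def lepoll_iff_ordLeq[symmetric] intro: lepoll_antisym)
  then have le: "|X| \<le>o r"
    using card_of_least[OF \<open>Well_order r\<close>] ordLeq_transitive by blast
  have "\<not> |X| =o r"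
  proof
    assume "|X| =o r"
    then obtain f where "iso r |X| f"
      using ordIso_symmetric unfolding ordIso_def by blast
    then have "bij_betw f {..<\<kappa>} X"
      by (auto simp: iso_def F Field_card_of)
    then show False
      using ne by (meson eqpoll_def eqpoll_imp_lepoll)
  qed
  then have "|X| <o r"
    using le ordLeq_iff_ordLess_or_ordIso by blast
  then obtain b where b: "b \<in> Field r" "|X| =o Restr r (underS r b)"
    using ordLess_iff_ordIso_Restr[OF \<open>Well_order r\<close> card_of_Well_order] by blast
  have "b < \<kappa>"
    using b(1) by (simp add: F)
  then have "underS r b = {..<b}" "Field (Restr r {..<b}) = {..<b}"
    by (auto simp: underS_def r_def Field_def)
  then obtain f where "bij_betw f X {..<b}"
    using b(2) by (auto simp: ordIso_def iso_def Field_card_of)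
  then show ?thesis
    using \<open>b < \<kappa>\<close> that by (auto simp: eqpoll_def)
qed

lemma bounded_below_cf:
  fixes \<kappa> \<Lambda> :: "'a::wellorder"
  assumes "X \<prec> {..<\<kappa>}" "\<kappa> \<le> cf \<Lambda>" "f ` X \<subseteq> {..<\<Lambda>}"
  obtains \<xi> where "\<xi> < \<Lambda>" "\<And>x. x \<in> X \<Longrightarrow> f x < \<xi>"
proof -
  obtain \<beta> where "\<beta> < \<kappa>" "X \<approx> {..<\<beta>}"
    using assms(1) by (rule lesspoll_imp_eqpoll_segment)
  then obtain g where g: "bij_betw g {..<\<beta>} X"
    using eqpoll_sym eqpoll_def by blast
  have "\<beta> < cf \<Lambda>"
    using \<open>\<beta> < \<kappa>\<close> assms(2) by simp
  from not_less_Least[OF this[unfolded cf_def]]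
  have "\<not> ((f \<circ> g) ` {..<\<beta>} \<subseteq> {..<\<Lambda>} \<and> (\<forall>\<xi><\<Lambda>. \<exists>\<eta><\<beta>. \<xi> \<le> (f \<circ> g) \<eta>))"
    by blast
  moreover have "(f \<circ> g) ` {..<\<beta>} \<subseteq> {..<\<Lambda>}"
    using g assms(3) by (auto simp: bij_betw_def)
  ultimately obtain \<xi> where "\<xi> < \<Lambda>" "\<forall>\<eta><\<beta>. f (g \<eta>) < \<xi>"
    by (auto simp: not_le)
  moreover have "\<exists>\<eta><\<beta>. x = g \<eta>" if "x \<in> X" for x
    using g that by (auto simp: bij_betw_def)
  ultimately show ?thesis
    using that by blast
qed

lemma countable_lesspoll:
  assumes "countable X" "uncountable Y"
  shows "X \<prec> Y"
proof -
  have "infinite Y"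
    using assms(2) countable_finite by blast
  then have "X \<lesssim> Y"
    using assms(1) by (meson countableE_infinite countable_def infinite_le_lepoll lepoll_def lepoll_trans subset_UNIV)
  then show ?thesis
    using assms by (metis countable_lepoll eqpoll_imp_lepoll eqpoll_sym lesspoll_def)
qed

lemma image_lesspoll: "X \<prec> Y \<Longrightarrow> f ` X \<prec> Y"
  using image_lepoll lesspoll_trans1 by blast

lemma subset_lesspoll: "X \<subseteq> X' \<Longrightarrow> X' \<prec> Y \<Longrightarrow> X \<prec> Y"
  using subset_imp_lepoll lesspoll_trans1 by blast

text \<open>Regularity yields one \<open>\<mu> < \<kappa>\<close> that bounds the index set and all
  members of the family at once. If \<open>\<mu>\<close> is infinite, it bounds the union as well;
  if it is finite, the union is finite.\<close>

lemma regular_UN_lesspoll: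
  fixes \<kappa> :: "'a::wellorder"
  assumes "cardinal \<kappa>" "regular \<kappa>" "I \<prec> {..<\<kappa>}" "\<And>i. i \<in> I \<Longrightarrow> A i \<prec> {..<\<kappa>}"
  shows "(\<Union>i\<in>I. A i) \<prec> {..<\<kappa>}"
proof -
  obtain \<delta> where \<delta>: "\<delta> < \<kappa>" "I \<approx> {..<\<delta>}"
    using assms(3) by (rule lesspoll_imp_eqpoll_segment)
  have "\<exists>\<beta><\<kappa>. A i \<approx> {..<\<beta>}" if "i \<in> I" for i
    using lesspoll_imp_eqpoll_segment[OF assms(4)[OF that]] by blast
  then obtain f where f: "\<And>i. i \<in> I \<Longrightarrow> f i < \<kappa> \<and> A i \<approx> {..<f i}"
    by metis
  obtain \<xi> where \<xi>: "\<xi> < \<kappa>" "\<And>i. i \<in> I \<Longrightarrow> f i < \<xi>"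
    using bounded_below_cf[OF assms(3), of \<kappa> f] assms(2) f by (auto simp: regular_def)
  define \<mu> where "\<mu> = max \<delta> \<xi>"
  have "\<mu> < \<kappa>"
    using \<delta> \<xi> by (simp add: \<mu>_def)
  have I: "I \<lesssim> {..<\<mu>}"
    by (rule lepoll_trans[OF eqpoll_imp_lepoll[OF \<delta>(2)]])
      (auto intro!: subset_imp_lepoll simp: \<mu>_def)
  have A: "A i \<lesssim> {..<\<mu>}" if "i \<in> I" for i
  proof (rule lepoll_trans[OF eqpoll_imp_lepoll])
    show "A i \<approx> {..<f i}" using f that by blast
    show "{..<f i} \<lesssim> {..<\<mu>}"
      using less_imp_le[OF \<xi>(2)[OF that]]
      by (auto intro!: subset_imp_lepoll simp: \<mu>_def le_max_iff_disj)
  qed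
  have inf: "infinite {..<\<kappa>}"
    using assms(2) by (simp add: regular_def)
  show ?thesis
  proof (cases "finite {..<\<mu>}")
    case True
    then have "finite (\<Union>i\<in>I. A i)"
      using I A by (meson finite_UN_I lepoll_def finite_surj inj_on_finite)
    then show ?thesis
      using inf by (simp add: finite_lesspoll_infinite)
  next
    case False
    then have "(\<Union>i\<in>I. A i) \<lesssim> {..<\<mu>}"
      using I A card_of_UNION_ordLeq_infinite[of "{..<\<mu>}" I A] by (auto simp: lepoll_iff_ordLeq)
    moreover have "{..<\<mu>} \<prec> {..<\<kappa>}"
      using assms(1) \<open>\<mu> < \<kappa>\<close>
      by (auto simp: cardinal_def lesspoll_def intro!: subset_imp_lepoll)
    ultimately show ?thesis
      using lesspoll_trans1 by blast
  qed
qed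

lemma regular_Un_lesspoll:
  fixes \<kappa> :: "'a::wellorder"
  assumes "cardinal \<kappa>" "regular \<kappa>" "X \<prec> {..<\<kappa>}" "Y \<prec> {..<\<kappa>}"
  shows "X \<union> Y \<prec> {..<\<kappa>}"
proof -
  have "(\<Union>b\<in>UNIV. if b then X else Y) \<prec> {..<\<kappa>}"
    using assms by (intro regular_UN_lesspoll)
      (auto simp: regular_def intro: finite_lesspoll_infinite)
  then show ?thesis
    by (simp add: UNIV_bool Un_commute)
qed

lemma regular_lists_lesspoll:
  fixes \<kappa> :: "'a::wellorder"
  assumes "cardinal \<kappa>" "regular \<kappa>" "uncountable {..<\<kappa>}" "X \<prec> {..<\<kappa>}"
  shows "lists X \<prec> {..<\<kappa>}"
proof -
  have *: "{xs \<in> lists X. length xs = n} \<prec> {..<\<kappa>}" for n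
  proof (induction n)
    case 0
    have "finite {xs \<in> lists X. length xs = 0}"
      by (rule finite_subset[of _ "{[]}"]) auto
    moreover have "infinite {..<\<kappa>}"
      using assms(2) by (simp add: regular_def)
    ultimately show ?case
      by (rule finite_lesspoll_infinite[rotated])
  next
    case (Suc n)
    have "{xs \<in> lists X. length xs = Suc n} = (\<Union>x\<in>X. (#) x ` {xs \<in> lists X. length xs = n})"
      by (auto simp: length_Suc_conv image_iff)
    then show ?case
      using Suc assms by (auto intro!: regular_UN_lesspoll image_lesspoll)
  qed
  have "lists X = (\<Union>n. {xs \<in> lists X. length xs = n})"
    by auto
  also have "\<dots> \<prec> {..<\<kappa>}"
    using countable_lesspoll[OF countableI_type assms(3)] *
    by (rule regular_UN_lesspoll[OF assms(1,2)])
  finally show ?thesis .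
qed

text \<open>The closure is exhausted in countably many stages, and each stage replaces a point by
  countably many, so regularity and uncountability of \<open>\<kappa>\<close> keep it small.\<close>

lemma regular_rtrancl_lesspoll:
  fixes \<kappa> :: "'a::wellorder"
  assumes "cardinal \<kappa>" "regular \<kappa>" "uncountable {..<\<kappa>}" "X \<prec> {..<\<kappa>}"
    and R: "\<And>x. countable (R `` {x})"
  shows "R\<^sup>* `` X \<prec> {..<\<kappa>}"
proof -
  have *: "(R ^^ n) `` X \<prec> {..<\<kappa>}" for n
  proof (induction n)
    case 0
    then show ?case using assms by simp
  next
    case (Suc n)
    have "(R ^^ Suc n) `` X = (\<Union>x\<in>(R ^^ n) `` X. R `` {x})"
      by auto
    also have "\<dots> \<prec> {..<\<kappa>}"
      using Suc countable_lesspoll[OF R assms(3)] by (rule regular_UN_lesspoll[OF assms(1,2)])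
    finally show ?case .
  qed
  have "R\<^sup>* `` X = (\<Union>n. (R ^^ n) `` X)"
    by (auto simp: rtrancl_is_UN_relpow)
  also have "\<dots> \<prec> {..<\<kappa>}"
    using countable_lesspoll[OF countableI_type assms(3)] *
    by (rule regular_UN_lesspoll[OF assms(1,2)])
  finally show ?thesis .
qed

text \<open>An initial segment of \<open>c\<close> other than \<open>c\<close> itself is cut off by
  the least element of \<open>c\<close> outside it. Hence the points of \<open>c\<close> and one
  extra value index all segments, although \<open>\<xi>\<close> ranges over the whole type.\<close>

lemma initial_segments_lesspoll:
  fixes \<kappa> :: "'a::wellorder" and c :: "'a set"
  assumes "cardinal \<kappa>" "regular \<kappa>" "c \<prec> {..<\<kappa>}"
  shows "range (\<lambda>\<xi>. c \<inter> {..<\<xi>}) \<prec> {..<\<kappa>}"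
proof -
  have "range (\<lambda>\<xi>. c \<inter> {..<\<xi>}) \<subseteq> {c} \<union> (\<lambda>\<xi>. c \<inter> {..<\<xi>}) ` c"
  proof clarsimp
    fix \<xi> assume "c \<inter> {..<\<xi>} \<notin> (\<lambda>\<xi>. c \<inter> {..<\<xi>}) ` c" 
    show "c \<inter> {..<\<xi>} = c"
    proof (rule ccontr)
      assume "c \<inter> {..<\<xi>} \<noteq> c"
      then obtain y where y: "y \<in> c \<and> \<xi> \<le> y"
        using not_le by blast
      define z where "z = (LEAST y. y \<in> c \<and> \<xi> \<le> y)"
      have z: "z \<in> c \<and> \<xi> \<le> z"
        unfolding z_def using y by (rule LeastI)
      have "y < \<xi>" if "y \<in> c" "y < z" for y
        using not_less_Least[OF that(2)[unfolded z_def]] that by auto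
      then have "c \<inter> {..<\<xi>} = c \<inter> {..<z}"
        using z by auto
      with z \<open>c \<inter> {..<\<xi>} \<notin> _\<close> show False by blast
    qed
  qed
  moreover have "{c} \<union> (\<lambda>\<xi>. c \<inter> {..<\<xi>}) ` c \<prec> {..<\<kappa>}"
    using assms by (intro regular_Un_lesspoll image_lesspoll)
      (auto simp: regular_def intro: finite_lesspoll_infinite)
  ultimately show ?thesis
    by (rule subset_lesspoll)
qed

section \<open>Countable cofinality and limit points\<close>

text \<open>An ordinal below the least limit is zero or a successor, so by induction it has finitely
  many predecessors, and their number determines it.\<close>

lemma countable_below_omega: "countable {..<omega :: 'a::wellorder}"
proof -
  have fin: "finite {..<x}" if "x < omega" for x :: 'a
    using that
  proof (induction x rule: less_induct)
    case (less x)
    have "\<not> limit_ord x"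
      using not_less_Least less.prems unfolding omega_def by blast
    then consider "{..<x} = {}" | b where "b < x" "\<forall>\<gamma>. \<not> (b < \<gamma> \<and> \<gamma> < x)"
      unfolding limit_ord_def by auto
    then show ?case
    proof cases
      case 2
      then have "{..<x} = insert b {..<b}"
        by (auto simp: not_less intro: le_neq_trans)
      then show ?thesis
        using less.IH[of b] less.prems 2 by (metis finite_insert less_trans)
    qed simp
  qed
  have "inj_on (\<lambda>x::'a. card {..<x}) {..<omega}"
  proof (rule linorder_inj_onI')
    fix x y :: 'a
    assume "x \<in> {..<omega}" "y \<in> {..<omega}" "x < y"
    then have "card {..<x} < card {..<y}"
      by (intro psubset_card_mono fin) auto
    then show "card {..<x} \<noteq> card {..<y}" by simp
  qed
  then show ?thesis
    by (rule countableI)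
qed

lemma cof_omega_ladder:
  fixes \<delta> :: "'a::wellorder"
  assumes "limit_ord \<delta>" "\<delta> \<in> cof_omega"
  obtains l :: "nat \<Rightarrow> 'a"
  where "mono l" "\<And>n. l n < \<delta>" "\<And>\<xi>. \<xi> < \<delta> \<Longrightarrow> \<exists>n. \<xi> < l n"
proof -
  have "\<exists>f. f ` {..<cf \<delta>} \<subseteq> {..<\<delta>} \<and> (\<forall>\<xi><\<delta>. \<exists>\<eta><cf \<delta>. \<xi> \<le> f \<eta>)"
    unfolding cf_def by (rule LeastI[of _ \<delta>], rule exI[of _ id]) auto
  then obtain f :: "'a \<Rightarrow> 'a" where f: "f ` {..<omega} \<subseteq> {..<\<delta>}" "\<And>\<xi>. \<xi> < \<delta> \<Longrightarrow> \<exists>\<eta> < omega. \<xi> \<le> f \<eta>"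
    using assms(2) by (auto simp: cof_omega_def)
  define X where "X = f ` {..<omega}"
  have "countable X"
    by (simp add: X_def countable_below_omega)
  have "X \<noteq> {}"
    using assms(1) f(2) by (auto simp: X_def limit_ord_def)
  \<comment> \<open>Running maxima turn an arbitrary enumeration of the cofinal set into a monotone
    one.\<close>
  define l where "l n = Max (from_nat_into X ` {..n})" for n
  show ?thesis
  proof
    show "mono l"
      unfolding l_def by (intro monoI Max_mono image_mono) auto
    show "l n < \<delta>" for n
    proof -
      have "from_nat_into X m < \<delta>" for m
        using f(1) from_nat_into[OF \<open>X \<noteq> {}\<close>, of m] by (auto simp: X_def)
      then show ?thesis
        by (simp add: l_def)
    qed
    fix \<xi> assume "\<xi> < \<delta>"
    \<comment> \<open>The cofinal map only reaches \<open>\<le>\<close>; aiming at a larger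
      \<open>\<xi>'\<close> makes the inequality strict.\<close>
    then obtain \<xi>' where "\<xi> < \<xi>'" "\<xi>' < \<delta>"
      using assms(1) by (auto simp: limit_ord_def)
    then obtain x where "x \<in> X" "\<xi>' \<le> x"
      using f(2)[OF \<open>\<xi>' < \<delta>\<close>] by (auto simp: X_def)
    moreover obtain n where "from_nat_into X n = x"
      using from_nat_into_surj[OF \<open>countable X\<close> \<open>x \<in> X\<close>] by blast
    ultimately have "\<xi>' \<le> l n"
      by (auto simp: l_def Max_ge_iff)
    then show "\<exists>n. \<xi> < l n"
      using \<open>\<xi> < \<xi>'\<close> by (metis less_le_trans)
  qed
qed

lemma limit_points_cofinal:
  assumes "\<delta> \<in> limit_points a" "\<xi> < \<delta>"
  shows "\<exists>x\<in>a. \<xi> < x \<and> x < \<delta>"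
proof -
  have "\<xi> < sup_ord (a \<inter> {..<\<delta>})"
    using assms by (simp add: limit_points_def)
  from not_less_Least[OF this[unfolded sup_ord_def]] show ?thesis
    by (auto simp: not_le)
qed

lemma sup_ord_cofinal:
  fixes \<delta> :: "'a::wellorder"
  assumes "\<And>\<xi>. \<xi> < \<delta> \<Longrightarrow> \<exists>x\<in>c. \<xi> < x \<and> x < \<delta>"
  shows "sup_ord (c \<inter> {..<\<delta>}) = \<delta>"
  unfolding sup_ord_def
proof (rule Least_equality)
  fix \<beta> assume "\<forall>\<xi>\<in>c \<inter> {..<\<delta>}. \<xi> \<le> \<beta>"
  then show "\<delta> \<le> \<beta>"
    using assms by (meson IntI lessThan_iff not_le)
qed auto

section \<open>Clubs of closed sets and a pairing function\<close>

lemma Pk_Un: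
  assumes "cardinal \<kappa>" "regular \<kappa>" "a \<in> Pk \<kappa> \<Lambda>" "b \<in> Pk \<kappa> \<Lambda>"
  shows "a \<union> b \<in> Pk \<kappa> \<Lambda>"
  using assms by (auto simp: Pk_def intro: regular_Un_lesspoll)

text \<open>Closing a small set under a relation with countable branching keeps it small, and being
  closed passes to unions. The lower bound \<open>b\<close> serves to show later that a stationary
  set is cofinal even after intersection with a club of closed sets.\<close>

lemma club_closed_above:
  fixes \<kappa> \<Lambda> :: "'a::wellorder"
  assumes "cardinal \<kappa>" "regular \<kappa>" "uncountable {..<\<kappa>}"
    and "b \<in> Pk \<kappa> \<Lambda>" "\<And>x. countable (R `` {x})" "R `` {..<\<Lambda>} \<subseteq> {..<\<Lambda>}"
  shows "club \<kappa> \<Lambda> {x \<in> Pk \<kappa> \<Lambda>. b \<subseteq> x \<and> R `` x \<subseteq> x}"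
  unfolding club_def
proof (intro conjI ballI allI impI)
  fix a assume "a \<in> Pk \<kappa> \<Lambda>"
  then have ab: "a \<union> b \<in> Pk \<kappa> \<Lambda>"
    using assms Pk_Un by blast
  let ?c = "R\<^sup>* `` (a \<union> b)"
  have "?c \<subseteq> {..<\<Lambda>}"
  proof -
    have "y \<in> {..<\<Lambda>}" if "(x, y) \<in> R\<^sup>*" "x \<in> {..<\<Lambda>}" for x y
      using that assms(6) by (induction rule: rtrancl_induct) auto
    then show ?thesis
      using ab unfolding Pk_def by blast
  qed
  moreover have "?c \<prec> {..<\<kappa>}"
    using assms(1-3,5) ab by (auto simp: Pk_def intro: regular_rtrancl_lesspoll)
  ultimately have "?c \<in> {x \<in> Pk \<kappa> \<Lambda>. b \<subseteq> x \<and> R `` x \<subseteq> x}"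
    by (auto simp: Pk_def intro: rtrancl_into_rtrancl)
  moreover have "a \<subseteq> ?c"
    by auto
  ultimately show "\<exists>c\<in>{x \<in> Pk \<kappa> \<Lambda>. b \<subseteq> x \<and> R `` x \<subseteq> x}. a \<subseteq> c"
    by (rule rev_bexI)
next
  fix D
  assume D: "subset.chain {x \<in> Pk \<kappa> \<Lambda>. b \<subseteq> x \<and> R `` x \<subseteq> x} D \<and> D \<noteq> {} \<and> D \<prec> {..<\<kappa>}"
  then have sub: "D \<subseteq> {x \<in> Pk \<kappa> \<Lambda>. b \<subseteq> x \<and> R `` x \<subseteq> x}"
    by (simp add: subset.chain_def)
  have "(\<Union>x\<in>D. x) \<prec> {..<\<kappa>}"
    using sub D assms(1,2) by (intro regular_UN_lesspoll) (auto simp: Pk_def)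
  then show "\<Union>D \<in> {x \<in> Pk \<kappa> \<Lambda>. b \<subseteq> x \<and> R `` x \<subseteq> x}"
    using sub D by (auto simp: Pk_def) blast+
qed auto

lemma countable_pairing:
  assumes "infinite X"
  obtains p :: "'a \<Rightarrow> nat \<Rightarrow> 'a"
  where "\<And>x n. x \<in> X \<Longrightarrow> p x n \<in> X"
    and "\<And>x y m n. \<lbrakk>x \<in> X; y \<in> X\<rbrakk> \<Longrightarrow> p x m = p y n \<longleftrightarrow> x = y \<and> m = n"
proof -
  have "|UNIV :: nat set| \<le>o |X|"
    using assms infinite_iff_card_of_nat by blast
  then have "|X \<times> (UNIV :: nat set)| =o |X|"
    using card_of_Times_infinite[OF assms] by blast
  then have "X \<times> (UNIV :: nat set) \<lesssim> X"
    by (simp add: lepoll_iff_ordLeq ordIso_imp_ordLeq)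
  then obtain g where g: "inj_on g (X \<times> (UNIV :: nat set))" "g ` (X \<times> UNIV) \<subseteq> X"
    by (auto simp: lepoll_def)
  show ?thesis
  proof
    show "g (x, n) \<in> X" if "x \<in> X" for x n
      using g(2) that by auto
    show "g (x, m) = g (y, n) \<longleftrightarrow> x = y \<and> m = n" if "x \<in> X" "y \<in> X" for x y m n
      using inj_on_eq_iff[OF g(1), of "(x, m)" "(y, n)"] that by simp
  qed
qed

section \<open>The list of coded ladders and its thinness\<close>

locale ladder_coding =
  fixes \<kappa> \<Lambda> :: "'a::wellorder" and p :: "'a \<Rightarrow> nat \<Rightarrow> 'a" and l :: "'a \<Rightarrow> nat \<Rightarrow> 'a"
  assumes card: "cardinal \<kappa>" and reg: "regular \<kappa>" and unc: "uncountable {..<\<kappa>}"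
    and cf: "\<kappa> \<le> cf \<Lambda>"
    and p_less: "x < \<Lambda> \<Longrightarrow> p x n < \<Lambda>"
    and p_eq_iff: "\<lbrakk>x < \<Lambda>; y < \<Lambda>\<rbrakk> \<Longrightarrow> p x m = p y n \<longleftrightarrow> x = y \<and> m = n"
    and l_mono: "\<lbrakk>limit_ord \<delta>; \<delta> \<in> cof_omega\<rbrakk> \<Longrightarrow> mono (l \<delta>)"
    and l_less: "\<lbrakk>limit_ord \<delta>; \<delta> \<in> cof_omega\<rbrakk> \<Longrightarrow> l \<delta> n < \<delta>"
    and l_cofinal: "\<lbrakk>limit_ord \<delta>; \<delta> \<in> cof_omega; \<xi> < \<delta>\<rbrakk> \<Longrightarrow> \<exists>n. \<xi> < l \<delta> n"
begin

text \<open>Both directions are included so that a closed set contains the code \<open>p x n\<close>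
  exactly when it contains \<open>x\<close>.\<close>

definition code_rel :: "('a \<times> 'a) set" where
  "code_rel = {(x, p x n) | x n. x < \<Lambda>} \<union> {(p x n, x) | x n. x < \<Lambda>}"

definition code_closed :: "'a set set" where
  "code_closed = {a \<in> Pk \<kappa> \<Lambda>. code_rel `` a \<subseteq> a}"

definition bad :: "'a set set" where
  "bad = {a \<in> Pk \<kappa> \<Lambda>. \<not> limit_points a \<inter> cof_omega \<subseteq> a}"

definition gap :: "'a set \<Rightarrow> 'a" where
  "gap a = (SOME \<eta>. \<eta> \<in> limit_points a \<inter> cof_omega - a)"

text \<open>Closure under \<open>code_rel\<close> puts the codes inside \<open>a\<close>, as a list
  requires. The default \<open>{}\<close> off the club \<open>code_closed\<close> does no harm,
  since a stationary set may be cut down to that club.\<close>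

definition ladder_list :: "'a set \<Rightarrow> 'a set" where
  "ladder_list a = (if a \<in> bad \<inter> code_closed then {p x n | x n. x \<in> a \<and> x < l (gap a) n} else {})"

lemma gap:
  assumes "a \<in> bad"
  shows "gap a \<in> limit_points a" "limit_ord (gap a)" "gap a \<in> cof_omega" "gap a \<notin> a"
proof -
  have "\<exists>\<eta>. \<eta> \<in> limit_points a \<inter> cof_omega - a"
    using assms by (auto simp: bad_def)
  then have "gap a \<in> limit_points a \<inter> cof_omega - a"
    unfolding gap_def by (rule someI_ex)
  then show "gap a \<in> limit_points a" "limit_ord (gap a)" "gap a \<in> cof_omega" "gap a \<notin> a"
    by (auto simp: limit_points_def)
qed

lemma code_in_iff:
  assumes "a \<in> code_closed" "x < \<Lambda>"
  shows "p x n \<in> a \<longleftrightarrow> x \<in> a"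
proof -
  have "(x, p x n) \<in> code_rel" "(p x n, x) \<in> code_rel"
    using assms(2) by (auto simp: code_rel_def)
  then show ?thesis
    using assms(1) unfolding code_closed_def by blast
qed

lemma code_closed_less:
  assumes "a \<in> code_closed" "x \<in> a"
  shows "x < \<Lambda>"
  using assms by (auto simp: code_closed_def Pk_def)

lemma code_in_ladder_list_iff:
  assumes "a \<in> bad \<inter> code_closed" "x \<in> a"
  shows "p x n \<in> ladder_list a \<longleftrightarrow> x < l (gap a) n"
  using assms code_closed_less by (fastforce simp: ladder_list_def p_eq_iff)

lemma club_code_closed_above:
  assumes "b \<in> Pk \<kappa> \<Lambda>"
  shows "club \<kappa> \<Lambda> {a \<in> code_closed. b \<subseteq> a}"
proof -
  have "countable (code_rel `` {x})" for x
  proof -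
    have "code_rel `` {x} \<subseteq> range (p x) \<union> {y. y < \<Lambda> \<and> (\<exists>n. x = p y n)}"
      by (auto simp: code_rel_def)
    \<comment> \<open>By injectivity of the pairing, at most one \<open>y\<close> is decoded from
      \<open>x\<close>.\<close>
    moreover have "{y. y < \<Lambda> \<and> (\<exists>n. x = p y n)} \<subseteq> {THE y. y < \<Lambda> \<and> (\<exists>n. x = p y n)}"
      by (auto simp: p_eq_iff intro!: the_equality[symmetric])
    ultimately show ?thesis
      by (meson countable_Un countable_finite countable_image countable_subset finite.emptyI
          finite.insertI uncountable_def countableI_type)
  qed
  moreover have "code_rel `` {..<\<Lambda>} \<subseteq> {..<\<Lambda>}"
    by (auto simp: code_rel_def p_less)
  ultimately have "club \<kappa> \<Lambda> {x \<in> Pk \<kappa> \<Lambda>. b \<subseteq> x \<and> code_rel `` x \<subseteq> x}"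
    using assms by (intro club_closed_above card reg unc)
  moreover have "{x \<in> Pk \<kappa> \<Lambda>. b \<subseteq> x \<and> code_rel `` x \<subseteq> x} = {a \<in> code_closed. b \<subseteq> a}"
    by (auto simp: code_closed_def)
  ultimately show ?thesis
    by simp
qed

lemma ladder_list_subset: "ladder_list a \<subseteq> a"
  using code_closed_less code_in_iff by (auto simp: ladder_list_def)

text \<open>
  The trace on \<open>c\<close> depends only on the increasing sequence \<open>n \<mapsto> c \<inter> l\<^sub>\<eta>(n)\<close> of initial segments
  of \<open>c\<close>. If \<open>c\<close> is bounded below \<open>\<eta>\<close>, this sequence is eventually constant and hence given by a
  finite list; otherwise \<open>\<eta>\<close> is the supremum of an initial segment of \<open>c\<close>.
\<close>

lemma thin_ladder_list: "thin \<kappa> \<Lambda> ladder_list"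
  unfolding thin_def
proof (intro exI conjI ballI)
  have "{} \<in> Pk \<kappa> \<Lambda>"
    using countable_lesspoll[OF countable_empty unc] by (simp add: Pk_def)
  from club_code_closed_above[OF this] show "club \<kappa> \<Lambda> code_closed"
    by simp
  fix c assume c: "c \<in> code_closed"
  define J where "J = range (\<lambda>\<xi>. c \<inter> {..<\<xi>})"
  \<comment> \<open>\<open>F\<close> reads a finite list as an infinite sequence by repeating its
    last entry. \<open>G\<close> recovers the gap as the supremum of a segment of \<open>c\<close>.
    Neither refers to \<open>a\<close>, so their images bound the number of traces.\<close>
  define F where "F Is = {p x n | x n. x \<in> (if n < length Is then Is ! n else last Is)}" for Is
  define G where "G I = {p x n | x n. x \<in> c \<and> x < l (sup_ord I) n}" for I
  have J: "J \<prec> {..<\<kappa>}"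
    unfolding J_def using c by (intro initial_segments_lesspoll card reg) (simp add: code_closed_def Pk_def)
  have "ladder_list a \<inter> c \<in> {{}} \<union> F ` lists J \<union> G ` J" if "c \<subseteq> a" for a
  proof (cases "a \<in> bad \<inter> code_closed")
    case True
    define \<eta> where "\<eta> = gap a"
    have \<eta>: "limit_ord \<eta>" "\<eta> \<in> cof_omega"
      using gap True by (auto simp: \<eta>_def)
    \<comment> \<open>As \<open>c\<close> is closed, a code lies in \<open>c\<close> only if the
      coded ordinal does; thus \<open>a\<close> enters only through its gap
      \<open>\<eta>\<close>.\<close>
    have trace: "ladder_list a \<inter> c = {p x n | x n. x \<in> c \<and> x < l \<eta> n}"
      using True that code_in_iff[OF c] code_closed_less[of a] code_closed_less[OF c]
      by (auto simp: ladder_list_def \<eta>_def) blast+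
    show ?thesis
    proof (cases "\<forall>\<xi><\<eta>. \<exists>x\<in>c. \<xi> < x \<and> x < \<eta>")
      case True
      then have "sup_ord (c \<inter> {..<\<eta>}) = \<eta>"
        by (intro sup_ord_cofinal) blast
      then have "ladder_list a \<inter> c = G (c \<inter> {..<\<eta>})"
        by (simp add: trace G_def)
      then show ?thesis
        by (auto simp: J_def)
    next
      case False
      then obtain \<xi> where \<xi>: "\<xi> < \<eta>" "\<And>x. x \<in> c \<Longrightarrow> x < \<eta> \<Longrightarrow> x \<le> \<xi>"
        by (meson not_le)
      obtain m where m: "\<xi> < l \<eta> m"
        using l_cofinal[OF \<eta> \<xi>(1)] by blast
      \<comment> \<open>Points of \<open>c\<close> below \<open>\<eta>\<close> are at most
        \<open>\<xi>\<close>, hence below both ladder values; points from \<open>\<eta>\<close> on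
        are above both.\<close>
      have const: "x < l \<eta> n \<longleftrightarrow> x < l \<eta> m" if "m \<le> n" "x \<in> c" for x n
        using monoD[OF l_mono[OF \<eta>] that(1)] \<xi>(2)[OF that(2)] m l_less[OF \<eta>]
        by (meson le_less_trans less_le_trans less_trans)
      \<comment> \<open>There are \<open>Suc m\<close> entries, so that the repeated last one is the
        segment at \<open>m\<close>, where the sequence has become constant.\<close>
      define Is where "Is = map (\<lambda>n. c \<inter> {..<l \<eta> n}) [0..<Suc m]"
      have "last Is = c \<inter> {..<l \<eta> m}" "length Is = Suc m"
        by (simp_all add: Is_def)
      moreover have "Is ! n = c \<inter> {..<l \<eta> n}" if "n < Suc m" for n
        using that by (simp add: Is_def nth_append del: upt_Suc)
      ultimately have "x \<in> (if n < length Is then Is ! n else last Is) \<longleftrightarrow> x \<in> c \<and> x < l \<eta> n" for x n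
        using const[of n x] by auto
      then have "ladder_list a \<inter> c = F Is"
        by (simp add: trace F_def)
      moreover have "Is \<in> lists J"
        by (auto simp: Is_def J_def)
      ultimately show ?thesis
        by blast
    qed
  qed (auto simp: ladder_list_def)
  then have "{ladder_list a \<inter> c | a. c \<subseteq> a \<and> a \<in> Pk \<kappa> \<Lambda>} \<subseteq> {{}} \<union> F ` lists J \<union> G ` J"
    by blast
  moreover have "{{}} \<union> F ` lists J \<union> G ` J \<prec> {..<\<kappa>}"
    by (intro regular_Un_lesspoll image_lesspoll regular_lists_lesspoll card reg unc J
        countable_lesspoll[OF _ unc]) simp
  ultimately show "{ladder_list a \<inter> c | a. c \<subseteq> a \<and> a \<in> Pk \<kappa> \<Lambda>} \<prec> {..<\<kappa>}"
    by (rule subset_lesspoll)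
qed

section \<open>Effability\<close>

text \<open>Cofinality makes \<open>T\<close> directed, so the lists of any two members can be
  compared in a third. The glued segments then determine \<open>gap a\<close> on every
  \<open>a\<close> in \<open>T\<close>, and a suitable \<open>a\<close> contains the only ordinal
  that its gap could be.\<close>

lemma coherent_ladder_list_not_cofinal:
  assumes T: "T \<subseteq> bad \<inter> code_closed"
    and coherent: "\<And>a b. \<lbrakk>a \<in> T; b \<in> T; a \<subseteq> b\<rbrakk> \<Longrightarrow> ladder_list a = ladder_list b \<inter> a"
    and cofinal: "\<And>b. b \<in> Pk \<kappa> \<Lambda> \<Longrightarrow> \<exists>a\<in>T. b \<subseteq> a"
  shows False
proof -
  have T_Pk: "a \<in> Pk \<kappa> \<Lambda>" if "a \<in> T" for a
    using T that by (auto simp: bad_def)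
  define D where "D n = {x. x < \<Lambda> \<and> p x n \<in> (\<Union>a\<in>T. ladder_list a)}" for n
  have D_iff: "x \<in> D n \<longleftrightarrow> x < l (gap a) n" if "a \<in> T" "x \<in> a" for a x n
  proof -
    have a: "a \<in> bad \<inter> code_closed" "x < \<Lambda>"
      using T that code_closed_less by auto
    have "p x n \<in> ladder_list a" if b: "b \<in> T" "p x n \<in> ladder_list b" for b
    proof -
      \<comment> \<open>Coherence carries the code from \<open>b\<close> up to \<open>e\<close> and
        then down to \<open>a\<close>, which contains it because \<open>a\<close> is closed and
        \<open>x\<close> belongs to \<open>a\<close>.\<close>
      obtain e where "e \<in> T" "a \<union> b \<subseteq> e"
        using cofinal[OF Pk_Un[OF card reg T_Pk[OF \<open>a \<in> T\<close>] T_Pk[OF \<open>b \<in> T\<close>]]] by blast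
      then have "p x n \<in> ladder_list e" "ladder_list a = ladder_list e \<inter> a"
        using coherent[of b e] coherent[of a e] b \<open>a \<in> T\<close> by auto
      then show ?thesis
        using code_in_iff[of a x n] a \<open>x \<in> a\<close> by auto
    qed
    then show ?thesis
      using code_in_ladder_list_iff[OF a(1) \<open>x \<in> a\<close>] that a by (auto simp: D_def)
  qed
  have D_down: "y \<in> D n" if "x \<in> D n" "y < x" for x y n
  proof -
    have "x < \<Lambda>"
      using that by (simp add: D_def)
    then have "{x, y} \<in> Pk \<kappa> \<Lambda>"
      using that countable_lesspoll[OF _ unc, of "{x, y}"] by (auto simp: Pk_def)
    then obtain a where "a \<in> T" "{x, y} \<subseteq> a"
      using cofinal by blast
    then show ?thesis
      using D_iff[of a x n] D_iff[of a y n] that by auto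
  qed
  have D_UN: "x \<in> (\<Union>n. D n) \<longleftrightarrow> x < gap a" if "a \<in> T" "x \<in> a" for a x
    using D_iff[OF that] l_less[of "gap a"] l_cofinal[of "gap a" x] gap[of a] T that less_trans
    by blast
  have "{} \<in> Pk \<kappa> \<Lambda>"
    using countable_lesspoll[OF countable_empty unc] by (simp add: Pk_def)
  then obtain a0 where a0: "a0 \<in> T"
    using cofinal by blast
  \<comment> \<open>Since \<open>gap a0\<close> is a limit point of \<open>a0\<close>, points of
    \<open>a0\<close> lie between each ladder value and the gap. They give a sequence
    \<open>\<gamma>\<close> in one member of \<open>T\<close> with \<open>\<gamma> n\<close> outside
    \<open>D n\<close> but inside the union of all segments.\<close>
  have "\<exists>x. x \<in> a0 \<and> x < gap a0 \<and> l (gap a0) n < x" for n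
    using limit_points_cofinal[of "gap a0" a0 "l (gap a0) n"] l_less[of "gap a0" n] gap[of a0] T a0
    by blast
  then obtain \<gamma> where \<gamma>: "\<And>n. \<gamma> n \<in> a0" "\<And>n. \<gamma> n < gap a0" "\<And>n. l (gap a0) n < \<gamma> n"
    by metis
  have \<gamma>_notin: "\<gamma> n \<notin> D n" for n
    using D_iff[OF a0 \<gamma>(1)] \<gamma>(3)[of n] by auto
  have \<gamma>_in: "\<gamma> n \<in> (\<Union>n. D n)" for n
    using D_UN[OF a0 \<gamma>(1)] \<gamma>(2) by blast
  have "range \<gamma> \<subseteq> {..<\<Lambda>}"
    using \<gamma>(1) T_Pk[OF a0] by (auto simp: Pk_def)
  then obtain \<xi> where \<xi>: "\<xi> < \<Lambda>" "\<And>n. \<gamma> n < \<xi>"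
    using bounded_below_cf[OF countable_lesspoll[OF _ unc] cf, of UNIV \<gamma>] by auto
  \<comment> \<open>This is the union of all the \<open>D n\<close>: each \<open>D n\<close> is an
    initial segment omitting \<open>\<gamma> n\<close>, while every \<open>\<gamma> n\<close> lies
    in some \<open>D m\<close>. Uncountable cofinality of \<open>\<Lambda>\<close> has put it below
    \<open>\<Lambda>\<close>, so it can be added to a member of \<open>T\<close>.\<close>
  define \<delta> where "\<delta> = (LEAST \<xi>. \<forall>n. \<gamma> n < \<xi>)"
  have \<delta>: "\<gamma> n < \<delta>" for n
    using LeastI[of "\<lambda>\<xi>. \<forall>n. \<gamma> n < \<xi>" \<xi>] \<xi>(2) by (simp add: \<delta>_def)
  have "\<delta> \<le> \<xi>"
    unfolding \<delta>_def using \<xi>(2) by (intro Least_le) blast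
  then have "{\<delta>} \<in> Pk \<kappa> \<Lambda>"
    using \<xi>(1) countable_lesspoll[OF _ unc, of "{\<delta>}"] by (auto simp: Pk_def)
  then obtain a where a: "a \<in> T" "a0 \<union> {\<delta>} \<subseteq> a"
    using cofinal[OF Pk_Un[OF card reg T_Pk[OF a0]]] by blast
  have "\<delta> \<notin> (\<Union>n. D n)"
    using D_down \<delta> \<gamma>_notin by blast
  then have "gap a \<le> \<delta>"
    using D_UN[OF a(1), of \<delta>] a(2) by auto
  moreover have "gap a \<noteq> \<delta>"
    using gap(4)[of a] T a by auto
  ultimately have "gap a < \<delta>"
    by simp
  \<comment> \<open>By minimality of \<open>\<delta>\<close> some \<open>\<gamma> n\<close> is not
    below \<open>gap a\<close>; yet it lies in \<open>a\<close> and in the union of the segments,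
    which on \<open>a\<close> is exactly the part below \<open>gap a\<close>.\<close>
  from not_less_Least[OF this[unfolded \<delta>_def]] obtain n where "\<not> \<gamma> n < gap a"
    by blast
  then show False
    using D_UN[OF a(1), of "\<gamma> n"] \<gamma>_in[of n] \<gamma>(1)[of n] a(2) by auto
qed

text \<open>A stationary \<open>S\<close> meets the club of closed sets above each \<open>b\<close>,
  so \<open>S \<inter> code_closed\<close> is cofinal and cannot be coherent.\<close>

lemma effable_ladder_list: "effable \<kappa> \<Lambda> bad ladder_list"
  unfolding effable_def
proof (intro allI impI, rule ccontr)
  fix S
  assume S: "S \<subseteq> bad \<and> stationary \<kappa> \<Lambda> S"
    and coherent: "\<not> (\<exists>a\<in>S. \<exists>b\<in>S. a \<subseteq> b \<and> ladder_list a \<noteq> ladder_list b \<inter> a)"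
  have "\<exists>a\<in>S \<inter> code_closed. b \<subseteq> a" if "b \<in> Pk \<kappa> \<Lambda>" for b
    using S club_code_closed_above[OF that] unfolding stationary_def by blast
  then show False
    using S coherent coherent_ladder_list_not_cofinal[of "S \<inter> code_closed"] by blast
qed

lemma bad_in_I_IT: "bad \<in> I_IT \<kappa> \<Lambda>"
  using thin_ladder_list effable_ladder_list ladder_list_subset
  by (auto simp: I_IT_def Pk_list_def bad_def)

end

theorem theorem3p5:
  fixes \<kappa> \<Lambda> :: "'a::wellorder"
  assumes "cardinal \<kappa>" and "cardinal \<Lambda>" and "\<kappa> \<le> \<Lambda>"
    and "regular \<kappa>" and "uncountable {..<\<kappa>}"
    and "\<kappa> \<le> cf \<Lambda>"
  shows "{a \<in> Pk \<kappa> \<Lambda>. limit_points a \<inter> cof_omega \<subseteq> a} \<in> F_IT \<kappa> \<Lambda>"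
proof -
  have "infinite {..<\<Lambda>}"
    using assms(3,4) by (meson finite_subset lessThan_subset_iff regular_def)
  then obtain p :: "'a \<Rightarrow> nat \<Rightarrow> 'a"
    where p: "\<And>x n. x \<in> {..<\<Lambda>} \<Longrightarrow> p x n \<in> {..<\<Lambda>}"
      "\<And>x y m n. \<lbrakk>x \<in> {..<\<Lambda>}; y \<in> {..<\<Lambda>}\<rbrakk> \<Longrightarrow> p x m = p y n \<longleftrightarrow> x = y \<and> m = n"
    using countable_pairing by blast
  have "\<exists>l :: nat \<Rightarrow> 'a. limit_ord \<delta> \<longrightarrow> \<delta> \<in> cof_omega \<longrightarrow>
      mono l \<and> (\<forall>n. l n < \<delta>) \<and> (\<forall>\<xi><\<delta>. \<exists>n. \<xi> < l n)" for \<delta> :: 'a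
    using cof_omega_ladder[of \<delta>] by metis
  then obtain l :: "'a \<Rightarrow> nat \<Rightarrow> 'a" where "\<And>\<delta>. limit_ord \<delta> \<longrightarrow> \<delta> \<in> cof_omega \<longrightarrow>
      mono (l \<delta>) \<and> (\<forall>n. l \<delta> n < \<delta>) \<and> (\<forall>\<xi><\<delta>. \<exists>n. \<xi> < l \<delta> n)"
    by metis
  then interpret ladder_coding \<kappa> \<Lambda> p l
    using assms p by unfold_locales auto
  have "{a \<in> Pk \<kappa> \<Lambda>. limit_points a \<inter> cof_omega \<subseteq> a} = Pk \<kappa> \<Lambda> - bad"
    by (auto simp: bad_def)
  then show ?thesis
    using bad_in_I_IT by (auto simp: F_IT_def)
qed

end
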